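(* Let $E_n$ be the number of labeled non-plane 1-2 trees on vertex set $[n]$, and let $A_{1,n}$ be the total number of vertices of rank $1$ in all such trees. Then \[\lim_{n\to\infty}\frac{A_{1,n}}{(n+1)E_n}=2-\frac{\pi^2}{24}-\frac{4}{\pi}\approx 0.3155269391.\]
   Context: A labeled non-plane 1-2 tree on vertex set $[n]=\{1,\dots,n\}$ is a rooted tree whose vertices are bijectively labeled by $[n]$, in which every vertex has at most two children, the label of each non-root vertex is less than the label of its parent, and the children of a vertex are unordered. The rank of a vertex $v$ is the number of edges in a shortest path from $v$ to a leaf that is a descendant of $v$ (leaves have rank $0$). $E_n$ is the $n$th Euler number, with $\sum_{n\ge0}E_nz^n/n!=\sec z+\tan z$. *)

theory Defs
  imports "HOL-Analysis.Analysis"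
begin

(* A rooted tree on the vertex set V is given by its set T of edges (parent, child), directed away
   from the root r. The children of a vertex form a set, hence are unordered. *)
definition rooted_tree :: "'a set \<Rightarrow> 'a \<Rightarrow> ('a \<times> 'a) set \<Rightarrow> bool" where
  "rooted_tree V r T \<longleftrightarrow>
     T \<subseteq> V \<times> V \<and> r \<in> V \<and>
     (\<forall>u. (u, r) \<notin> T) \<and>
     (\<forall>v \<in> V - {r}. \<exists>!u. (u, v) \<in> T) \<and>
     (\<forall>v \<in> V. (r, v) \<in> T\<^sup>*)"

definition children :: "('a \<times> 'a) set \<Rightarrow> 'a \<Rightarrow> 'a set" where
  "children T v = {w. (v, w) \<in> T}"

definition is_leaf :: "('a \<times> 'a) set \<Rightarrow> 'a \<Rightarrow> bool" where
  "is_leaf T v \<longleftrightarrow> children T v = {}"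

(* Vertices are identified with their labels. The root is determined by the edge set (it is the
   only vertex without a parent), so the trees may be counted as edge sets. *)
definition trees12 :: "nat \<Rightarrow> (nat \<times> nat) set set" where
  "trees12 n = {T. (\<exists>r. rooted_tree {1..n} r T) \<and>
                   (\<forall>v \<in> {1..n}. card (children T v) \<le> 2) \<and>
                   (\<forall>(u, v) \<in> T. v < u)}"

(* (v, w) \<in> T ^^ k says that there is a descending path with k edges from v to w. *)
definition vertex_rank :: "('a \<times> 'a) set \<Rightarrow> 'a \<Rightarrow> nat" where
  "vertex_rank T v = (LEAST k. \<exists>w. is_leaf T w \<and> (v, w) \<in> T ^^ k)"

definition num_trees :: "nat \<Rightarrow> nat" where
  "num_trees n = card (trees12 n)"

definition num_rank :: "nat \<Rightarrow> nat \<Rightarrow> nat" where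
  "num_rank k n = (\<Sum>T \<in> trees12 n. card {v \<in> {1..n}. vertex_rank T v = k})"

end

(* Deleting the root splits a tree into its two (possibly empty) root subtrees. Hence the exponential
   generating function Y of the trees, counting the empty tree, satisfies 2 Y' = 1 + Y^2, so
   Y = sec z + tan z, and that of the rank 1 vertices satisfies A' = A Y + z Y - z^2/2, the last two
   terms counting the trees whose root has a leaf child. Since Y' is an integrating factor,
   A = F Y' with the entire function F = 2 z sin z + 2 cos z - 2 - z^3/6 - z^2 cos z / 2. As Y has a
   simple pole at pi/2 with residue -2 and no other singularity in |z| < 3 pi/2, its coefficients
   behave like 2 (2/pi)^(n+1); multiplication by F turns this, by Tannery's theorem, into
   the limit F(pi/2) * 2/pi = 2 - pi^2/24 - 4/pi. *)

theory Submission
  imports Defs "HOL-Complex_Analysis.Complex_Analysis"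
begin

text \<open>Both series are defined by closed forms, and \<open>dec_trees_egf\<close> checks by
  induction over label sets that their coefficients obey the recurrences of the counts, so no
  differential equation has to be solved. The factor 2 comes from children being unordered: fixing
  which subtree holds the second largest label counts each unordered pair once, and complementation
  makes this half a sum over all label sets. In the doubled second equation, 2 z Y - z^2 is
  inclusion-exclusion for a single vertex as first or as second subtree. F is found by variation of
  constants: Y'' = Y Y' leaves F' Y' = z Y - z^2/2, and since 1/Y' = 1 - sin z and Y/Y' = cos z, F'
  is entire. The coefficient of z^n in Y' is n+1 times the next coefficient of Y, which explains the
  normalisation by (n+1) E_n; the remaining factor 2/pi is the limit ratio of consecutive
  coefficients of Y.\<close>

unbundle no vec_syntax

(* Decreasing labels make the reachability condition of a rooted tree automatic and force the root to
   be Max S, so that being a tree becomes a local condition. The empty edge set is the only element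
   for S = {}: it is the empty tree. *)
definition dec_trees :: "nat set \<Rightarrow> (nat \<times> nat) set set" where
  "dec_trees S = {T. T \<subseteq> S \<times> S \<and> (\<forall>(u, v) \<in> T. v < u) \<and>
     (\<forall>v \<in> S. v \<noteq> Max S \<longrightarrow> (\<exists>!u. (u, v) \<in> T)) \<and> (\<forall>u \<in> S. card (children T u) \<le> 2)}"

lemma dec_treesD:
  assumes "T \<in> dec_trees S"
  shows "T \<subseteq> S \<times> S" and "(u, v) \<in> T \<Longrightarrow> v < u"
    and "v \<in> S \<Longrightarrow> v \<noteq> Max S \<Longrightarrow> \<exists>u. (u, v) \<in> T"
    and "(u, v) \<in> T \<Longrightarrow> (u', v) \<in> T \<Longrightarrow> v \<noteq> Max S \<Longrightarrow> u = u'"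
    and "u \<in> S \<Longrightarrow> card (children T u) \<le> 2"
  using assms unfolding dec_trees_def by blast+

lemma finite_dec_trees: "finite S \<Longrightarrow> finite (dec_trees S)"
  by (rule finite_subset[of _ "Pow (S \<times> S)"]) (auto simp: dec_trees_def)

lemma dec_trees_empty: "dec_trees {} = {{}}"
  by (auto simp: dec_trees_def)

lemma dec_trees_singleton: "dec_trees {r} = {{}}"
  by (auto simp: dec_trees_def children_def)

text \<open>Every vertex other than \<open>Max S\<close> has a parent with a larger label, so
  climbing from \<open>v\<close> shrinks the distance to \<open>Max S\<close> and can only stop
  there.\<close>

lemma dec_trees_reach:
  assumes T: "T \<in> dec_trees S" and "finite S" and "v \<in> S"
  shows "(Max S, v) \<in> T\<^sup>*"
  using \<open>v \<in> S\<close>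
proof (induction "Max S - v" arbitrary: v rule: less_induct)
  case less
  show ?case
  proof (cases "v = Max S")
    case False
    obtain u where u: "(u, v) \<in> T" using dec_treesD(3)[OF T less.prems False] by blast
    have "u \<in> S" "v < u" using u dec_treesD(1,2)[OF T] by blast+
    moreover have "u \<le> Max S" using \<open>u \<in> S\<close> \<open>finite S\<close> by simp
    ultimately have "(Max S, u) \<in> T\<^sup>*" by (intro less.hyps diff_less_mono2) auto
    with u show ?thesis by (rule rtrancl_into_rtrancl[rotated])
  qed simp
qed

text \<open>The case n = 0 has to be excluded: \<open>trees12 0\<close> is empty because a rooted
  tree has a root, whereas \<open>dec_trees {}\<close> contains the empty tree.\<close>

lemma trees12_eq_dec_trees:
  assumes "n \<ge> 1"
  shows "trees12 n = dec_trees {1..n}"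
proof -
  have M: "Max {1..n} = n" using assms by (intro Max_eqI) auto
  show ?thesis
  proof (intro equalityI subsetI)
    fix T assume T: "T \<in> trees12 n"
    then obtain r where r: "rooted_tree {1..n} r T" by (auto simp: trees12_def)
    have lt: "\<forall>(u, v) \<in> T. v < u" using T by (auto simp: trees12_def)
    have "r = n"
    proof (rule ccontr)
      assume "r \<noteq> n"
      hence "n \<in> {1..n} - {r}" using assms by auto
      then obtain u where "(u, n) \<in> T" using r unfolding rooted_tree_def by blast
      moreover from this have "u \<in> {1..n}" using r unfolding rooted_tree_def by blast
      ultimately show False using lt by fastforce
    qed
    hence sub: "T \<subseteq> {1..n} \<times> {1..n}" and parent: "\<forall>v \<in> {1..n} - {n}. \<exists>!u. (u, v) \<in> T"
      using r unfolding rooted_tree_def by fast+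
    have "\<forall>v \<in> {1..n}. v \<noteq> n \<longrightarrow> (\<exists>!u. (u, v) \<in> T)"
    proof (intro ballI impI)
      fix v assume "v \<in> {1..n}" "v \<noteq> n"
      hence "v \<in> {1..n} - {n}" by blast
      thus "\<exists>!u. (u, v) \<in> T" by (rule bspec[OF parent])
    qed
    with T lt sub show "T \<in> dec_trees {1..n}"
      unfolding dec_trees_def trees12_def M mem_Collect_eq by simp
  next
    fix T assume T: "T \<in> dec_trees {1..n}"
    have "(u, n) \<notin> T" for u
    proof
      assume "(u, n) \<in> T"
      hence "u \<in> {1..n}" "n < u" using dec_treesD(1,2)[OF T] by blast+
      thus False by simp
    qed
    moreover have "\<forall>v \<in> {1..n}. (n, v) \<in> T\<^sup>*"
      using dec_trees_reach[OF T finite_atLeastAtMost] unfolding M by blast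
    moreover have "\<forall>v \<in> {1..n} - {n}. \<exists>!u. (u, v) \<in> T"
      using T unfolding dec_trees_def M by blast
    moreover have "n \<in> {1..n}" using assms by simp
    ultimately have "rooted_tree {1..n} n T"
      using dec_treesD(1)[OF T] by (simp only: rooted_tree_def simp_thms)
    thus "T \<in> trees12 n" using T unfolding trees12_def dec_trees_def mem_Collect_eq by (elim conjE) (intro conjI exI)
  qed
qed

section \<open>Rank 1 vertices as parents of leaves\<close>

definition rank1_vertices :: "('a \<times> 'a) set \<Rightarrow> 'a set" where
  "rank1_vertices T = {v. \<exists>w. (v, w) \<in> T \<and> children T w = {}}"

lemma vertex_rank_eq_1_iff:
  assumes T: "T \<in> dec_trees S" and "finite S"
  shows "vertex_rank T v = 1 \<longleftrightarrow> v \<in> rank1_vertices T"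
proof -
  define P where "P = (\<lambda>k. \<exists>w. is_leaf T w \<and> (v, w) \<in> T ^^ k)"
  have P0: "P 0 \<longleftrightarrow> children T v = {}" by (auto simp: P_def is_leaf_def)
  have P1: "P 1 \<longleftrightarrow> v \<in> rank1_vertices T" by (auto simp: P_def is_leaf_def rank1_vertices_def)
  have "wf (T\<inverse>)"
  proof -
    have "T\<inverse> \<subseteq> Wellfounded.measure id" using dec_treesD(2)[OF T] by auto
    thus ?thesis by (rule wf_subset[OF wf_measure])
  qed
  \<comment> \<open>\<open>LEAST\<close> is informative only once some descending path to a leaf is
    known to exist; decreasing labels give the well-founded induction for this.\<close>
  have ex: "\<exists>k. P k"
    unfolding P_def using \<open>wf (T\<inverse>)\<close>
  proof (induction v rule: wf_induct_rule)
    case (less v)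
    show ?case
    proof (cases "children T v = {}")
      case True
      hence "is_leaf T v \<and> (v, v) \<in> T ^^ 0" by (simp add: is_leaf_def)
      thus ?thesis by blast
    next
      case False
      then obtain c where c: "(v, c) \<in> T" by (auto simp: children_def)
      with less obtain k w where "is_leaf T w" "(c, w) \<in> T ^^ k" by blast
      with c have "(v, w) \<in> T ^^ Suc k" by (meson relpow_Suc_I2)
      with \<open>is_leaf T w\<close> show ?thesis by blast
    qed
  qed
  have "vertex_rank T v = (LEAST k. P k)" by (simp add: vertex_rank_def P_def)
  moreover have "(LEAST k. P k) = 1 \<longleftrightarrow> \<not> P 0 \<and> P 1"
  proof
    assume "(LEAST k. P k) = 1"
    thus "\<not> P 0 \<and> P 1" using LeastI_ex[OF ex] not_less_Least[of 0 P] by simp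
  next
    assume "\<not> P 0 \<and> P 1"
    thus "(LEAST k. P k) = 1" by (intro Least_equality) (auto simp: Suc_le_eq intro: gr0I)
  qed
  moreover have "\<not> P 0" if "P 1" using that P0 P1 by (auto simp: rank1_vertices_def children_def)
  ultimately show ?thesis using P1 by metis
qed

section \<open>Joining two trees under a new root, and splitting a tree at its root\<close>

text \<open>An empty subtree contributes no edge, so a root with fewer than two children needs no
  separate construction.\<close>

definition root_edge :: "nat \<Rightarrow> nat set \<Rightarrow> (nat \<times> nat) set" where
  "root_edge r A = (if A = {} then {} else {(r, Max A)})"

definition join_trees ::
  "nat \<Rightarrow> nat set \<Rightarrow> nat set \<Rightarrow> (nat \<times> nat) set \<Rightarrow> (nat \<times> nat) set \<Rightarrow> (nat \<times> nat) set" where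
  "join_trees r A B T1 T2 = T1 \<union> T2 \<union> root_edge r A \<union> root_edge r B"

lemma mem_root_edge: "(u, v) \<in> root_edge r A \<longleftrightarrow> A \<noteq> {} \<and> u = r \<and> v = Max A"
  by (auto simp: root_edge_def)

locale tree_join =
  fixes r :: nat and A B :: "nat set" and T1 T2 :: "(nat \<times> nat) set"
  assumes finA: "finite A" and finB: "finite B" and disj: "A \<inter> B = {}"
    and less_r: "\<And>x. x \<in> A \<union> B \<Longrightarrow> x < r"
    and T1: "T1 \<in> dec_trees A" and T2: "T2 \<in> dec_trees B"
begin

abbreviation "J \<equiv> join_trees r A B T1 T2"

lemma Max_in: "A \<noteq> {} \<Longrightarrow> Max A \<in> A" "B \<noteq> {} \<Longrightarrow> Max B \<in> B"
  using finA finB by auto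

lemma mem_J: "(u, v) \<in> J \<longleftrightarrow> (u, v) \<in> T1 \<or> (u, v) \<in> T2 \<or>
    u = r \<and> (A \<noteq> {} \<and> v = Max A \<or> B \<noteq> {} \<and> v = Max B)"
  by (auto simp: join_trees_def mem_root_edge)

lemma subtree_edgeD:
  "(u, v) \<in> T1 \<Longrightarrow> u \<in> A \<and> v \<in> A \<and> v < u"
  "(u, v) \<in> T2 \<Longrightarrow> u \<in> B \<and> v \<in> B \<and> v < u"
  using dec_treesD(1)[OF T1] dec_treesD(2)[OF T1, of u v] dec_treesD(1)[OF T2] dec_treesD(2)[OF T2, of u v]
  by auto

lemma disjointD: "x \<in> A \<Longrightarrow> x \<notin> B" "r \<notin> A" "r \<notin> B"
  using disj less_r[of r] by auto

lemma edge_into_A: "v \<in> A \<Longrightarrow> (u, v) \<in> J \<longleftrightarrow> (u, v) \<in> T1 \<or> u = r \<and> v = Max A"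
  using disjointD(1)[of v] Max_in(2) subtree_edgeD(2)[of u v] unfolding mem_J by (metis empty_iff)

lemma edge_into_B: "v \<in> B \<Longrightarrow> (u, v) \<in> J \<longleftrightarrow> (u, v) \<in> T2 \<or> u = r \<and> v = Max B"
  using disjointD(1)[of v] Max_in(1) subtree_edgeD(1)[of u v] unfolding mem_J by (metis empty_iff)

lemma edge_from_A: "u \<in> A \<Longrightarrow> (u, v) \<in> J \<longleftrightarrow> (u, v) \<in> T1"
  using disjointD(1)[of u] disjointD(2) subtree_edgeD(2)[of u v] unfolding mem_J by metis

lemma edge_from_B: "u \<in> B \<Longrightarrow> (u, v) \<in> J \<longleftrightarrow> (u, v) \<in> T2"
  using disjointD(1)[of u] disjointD(3) subtree_edgeD(1)[of u v] unfolding mem_J by metis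

lemma edge_from_r: "(r, v) \<in> J \<longleftrightarrow> A \<noteq> {} \<and> v = Max A \<or> B \<noteq> {} \<and> v = Max B"
  using disjointD(2,3) subtree_edgeD(1)[of r v] subtree_edgeD(2)[of r v] unfolding mem_J by metis

lemma top_not_child: "(u, Max A) \<notin> T1" "(u, Max B) \<notin> T2"
  using subtree_edgeD(1)[of u "Max A"] subtree_edgeD(2)[of u "Max B"] Max_ge[OF finA, of u] Max_ge[OF finB, of u]
  by auto

lemma Max_eq: "Max (insert r (A \<union> B)) = r"
  using less_r finA finB by (intro Max_eqI) (auto intro: less_imp_le)

lemma join_in_dec_trees: "J \<in> dec_trees (insert r (A \<union> B))"
proof -
  have "v < u \<and> u \<in> insert r (A \<union> B) \<and> v \<in> insert r (A \<union> B)" if "(u, v) \<in> J" for u v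
  proof -
    have "A \<noteq> {} \<Longrightarrow> Max A < r" "B \<noteq> {} \<Longrightarrow> Max B < r" by (simp_all add: Max_in less_r)
    with that show ?thesis
      using subtree_edgeD(1)[of u v] subtree_edgeD(2)[of u v] Max_in unfolding mem_J by (elim disjE conjE) simp_all
  qed
  hence 1: "J \<subseteq> insert r (A \<union> B) \<times> insert r (A \<union> B)" and 2: "\<forall>(u, v) \<in> J. v < u" by auto
  \<comment> \<open>The tops of the two subtrees have no parent there and get \<open>r\<close>;
    every other vertex keeps its old parent.\<close>
  have 3: "\<exists>!u. (u, v) \<in> J" if v: "v \<in> A \<union> B" for v
  proof (cases "v \<in> A")
    case vA: True
    show ?thesis
    proof (cases "v = Max A")
      case True
      hence "(u, v) \<in> J \<longleftrightarrow> u = r" for u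
        using edge_into_A[OF vA] top_not_child(1) by simp
      thus ?thesis by simp
    next
      case False
      hence J: "(u, v) \<in> J \<longleftrightarrow> (u, v) \<in> T1" for u using edge_into_A[OF vA] by simp
      obtain u where "(u, v) \<in> T1" using dec_treesD(3)[OF T1 vA False] by blast
      thus ?thesis unfolding J using dec_treesD(4)[OF T1 _ _ False] by (intro ex1I)
    qed
  next
    case False
    hence vB: "v \<in> B" using v by blast
    show ?thesis
    proof (cases "v = Max B")
      case True
      hence "(u, v) \<in> J \<longleftrightarrow> u = r" for u
        using edge_into_B[OF vB] top_not_child(2) by simp
      thus ?thesis by simp
    next
      case False
      hence J: "(u, v) \<in> J \<longleftrightarrow> (u, v) \<in> T2" for u using edge_into_B[OF vB] by simp
      obtain u where "(u, v) \<in> T2" using dec_treesD(3)[OF T2 vB False] by blast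
      thus ?thesis unfolding J using dec_treesD(4)[OF T2 _ _ False] by (intro ex1I)
    qed
  qed
  have 4: "card (children J u) \<le> 2" if u: "u \<in> insert r (A \<union> B)" for u
  proof -
    consider "u = r" | "u \<in> A" | "u \<in> B" using u by blast
    thus ?thesis
    proof cases
      case 1
      have "children J u \<subseteq> {Max A, Max B}" by (auto simp: children_def edge_from_r 1)
      hence "card (children J u) \<le> card {Max A, Max B}" by (rule card_mono[rotated]) simp
      thus ?thesis using card_insert_le_m1[of 2 "{Max B}" "Max A"] by simp
    next
      case 2
      thus ?thesis using dec_treesD(5)[OF T1] by (simp add: children_def edge_from_A)
    next
      case 3
      thus ?thesis using dec_treesD(5)[OF T2] by (simp add: children_def edge_from_B)
    qed
  qed
  show ?thesis unfolding dec_trees_def Max_eq using 1 2 3 4 less_r by (intro CollectI conjI ballI impI) auto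
qed

lemma restrict_join: "J \<inter> A \<times> A = T1" "J \<inter> B \<times> B = T2"
proof -
  have "T1 \<subseteq> A \<times> A" "T2 \<subseteq> B \<times> B" using dec_treesD(1)[OF T1] dec_treesD(1)[OF T2] .
  thus "J \<inter> A \<times> A = T1" "J \<inter> B \<times> B = T2"
    using edge_from_A edge_from_B by (auto 0 3)
qed

text \<open>No edge leaves \<open>A\<close>, so the label set of a subtree can be read off the
  joined tree. With \<open>restrict_join\<close> this shows that splitting undoes joining.\<close>

lemma descendants_join:
  assumes "A \<noteq> {}"
  shows "{v. (Max A, v) \<in> J\<^sup>*} = A"
proof (intro equalityI subsetI)
  fix v assume "v \<in> A"
  hence "(Max A, v) \<in> T1\<^sup>*" by (rule dec_trees_reach[OF T1 finA])
  moreover have "T1 \<subseteq> J" by (auto simp: join_trees_def)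
  ultimately show "v \<in> {v. (Max A, v) \<in> J\<^sup>*}" using rtrancl_mono by blast
next
  fix v assume "v \<in> {v. (Max A, v) \<in> J\<^sup>*}"
  hence "(Max A, v) \<in> J\<^sup>*" by simp
  thus "v \<in> A"
  proof induction
    case base
    show ?case by (rule Max_in(1)[OF assms])
  next
    case (step x y)
    thus ?case using edge_from_A[of x y] subtree_edgeD(1)[of x y] by simp
  qed
qed

text \<open>The top of a tree reaches all its vertices, so it is a leaf only if it is alone. This
  turns a condition on the tree into one on the size of its label set, which a generating function
  can record.\<close>

lemma root_child_leaf_iff: "X \<noteq> {} \<and> children T (Max X) = {} \<longleftrightarrow> card X = 1"
  if T: "T \<in> dec_trees X" and X: "finite X" for T X
proof
  assume *: "X \<noteq> {} \<and> children T (Max X) = {}"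
  have "v = Max X" if "v \<in> X" for v
    using dec_trees_reach[OF T X that] * by (auto simp: children_def elim: converse_rtranclE)
  hence "X = {Max X}" using * by blast
  thus "card X = 1" by (metis is_singletonI is_singleton_altdef)
next
  assume "card X = 1"
  then obtain x where "X = {x}" by (auto simp: card_1_singleton_iff)
  thus "X \<noteq> {} \<and> children T (Max X) = {}"
    using T by (auto simp: dec_trees_singleton children_def)
qed

text \<open>Vertices of the subtrees keep their children, so leaves stay leaves and only the new
  root can become an additional parent of a leaf.\<close>

lemma rank1_vertices_join:
  "rank1_vertices J = rank1_vertices T1 \<union> rank1_vertices T2 \<union>
     (if card A = 1 \<or> card B = 1 then {r} else {})"
proof -
  have leafA: "children J w = children T1 w" if "w \<in> A" for w
    unfolding children_def edge_from_A[OF that] ..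
  have leafB: "children J w = children T2 w" if "w \<in> B" for w
    unfolding children_def edge_from_B[OF that] ..
  have "(v, w) \<in> J \<and> children J w = {} \<longleftrightarrow>
      (v, w) \<in> T1 \<and> children T1 w = {} \<or> (v, w) \<in> T2 \<and> children T2 w = {} \<or>
      v = r \<and> (A \<noteq> {} \<and> w = Max A \<and> children T1 w = {} \<or> B \<noteq> {} \<and> w = Max B \<and> children T2 w = {})" for v w
  proof (cases "w \<in> A")
    case True
    hence "(v, w) \<notin> T2" "\<not> (B \<noteq> {} \<and> w = Max B)" "A \<noteq> {}"
      using subtree_edgeD(2)[of v w] disjointD(1)[OF True] Max_in(2) True by (metis empty_iff)+
    thus ?thesis unfolding edge_into_A[OF True] leafA[OF True] by blast
  next
    case False
    show ?thesis
    proof (cases "w \<in> B")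
      case True
      hence "(v, w) \<notin> T1" "\<not> (A \<noteq> {} \<and> w = Max A)" "B \<noteq> {}"
        using subtree_edgeD(1)[of v w] disjointD(1)[of w] Max_in(1) True by (metis empty_iff)+
      thus ?thesis unfolding edge_into_B[OF True] leafB[OF True] by blast
    next
      case False
      hence "(v, w) \<notin> T1" "(v, w) \<notin> T2" "\<not> (A \<noteq> {} \<and> w = Max A)" "\<not> (B \<noteq> {} \<and> w = Max B)"
        using \<open>w \<notin> A\<close> subtree_edgeD(1)[of v w] subtree_edgeD(2)[of v w] Max_in by metis+
      thus ?thesis unfolding mem_J by blast
    qed
  qed
  hence "v \<in> rank1_vertices J \<longleftrightarrow> v \<in> rank1_vertices T1 \<or> v \<in> rank1_vertices T2 \<or>
     v = r \<and> (A \<noteq> {} \<and> children T1 (Max A) = {} \<or> B \<noteq> {} \<and> children T2 (Max B) = {})" for v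
    unfolding rank1_vertices_def mem_Collect_eq by (simp only:) blast
  thus ?thesis
    unfolding root_child_leaf_iff[OF T1 finA] root_child_leaf_iff[OF T2 finB]
    by (intro set_eqI) simp
qed

lemma card_rank1_vertices_join:
  "card (rank1_vertices J) = card (rank1_vertices T1) + card (rank1_vertices T2) +
     of_bool (card A = 1 \<or> card B = 1)"
proof -
  have s: "rank1_vertices T1 \<subseteq> A" "rank1_vertices T2 \<subseteq> B"
    using dec_treesD(1)[OF T1] dec_treesD(1)[OF T2] by (auto simp: rank1_vertices_def)
  hence f: "finite (rank1_vertices T1)" "finite (rank1_vertices T2)"
    using finA finB finite_subset by auto
  have "card (rank1_vertices T1 \<union> rank1_vertices T2) = card (rank1_vertices T1) + card (rank1_vertices T2)"
    using f s disj by (intro card_Un_disjoint) auto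
  moreover have "r \<notin> rank1_vertices T1 \<union> rank1_vertices T2" using s disjointD by blast
  ultimately show ?thesis unfolding rank1_vertices_join using f by auto
qed

end


(* The subtree A is the one containing the second largest label, which is always a child of the root.
   This picks one order of the two unordered subtrees. *)
lemma dec_trees_split:
  assumes finS: "finite S" and less_r: "\<And>x. x \<in> S \<Longrightarrow> x < r" and ne: "S \<noteq> {}"
    and T: "T \<in> dec_trees (insert r S)"
  defines "A \<equiv> {v. (Max S, v) \<in> T\<^sup>*}"
  defines "B \<equiv> S - A"
  shows "Max S \<in> A" and "A \<subseteq> S" and "T \<inter> A \<times> A \<in> dec_trees A" and "T \<inter> B \<times> B \<in> dec_trees B"
    and "join_trees r A B (T \<inter> A \<times> A) (T \<inter> B \<times> B) = T"
proof -
  define m where "m = Max S"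
  have mS: "m \<in> S" using finS ne by (simp add: m_def)
  have le_m: "x \<le> m" if "x \<in> S" for x using that finS by (simp add: m_def)
  have Mx: "Max (insert r S) = r"
    using less_r finS by (intro Max_eqI) (auto intro: less_imp_le)
  have sub: "u \<in> insert r S \<and> v \<in> insert r S" if "(u, v) \<in> T" for u v
    using dec_treesD(1)[OF T] that by blast
  have lt: "v < u" if "(u, v) \<in> T" for u v using dec_treesD(2)[OF T that] .
  have childS: "v \<in> S" if "(u, v) \<in> T" for u v
    using sub[OF that] lt[OF that] less_r[of u] by fastforce
  have noteq_r: "v \<noteq> Max (insert r S)" if "v \<in> S" for v
    using less_r[OF that] by (simp add: Mx)
  have parent: "\<exists>u. (u, v) \<in> T" if "v \<in> S" for v
    using dec_treesD(3)[OF T _ noteq_r[OF that]] that by blast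
  have unique: "u = u'" if "(u, v) \<in> T" "(u', v) \<in> T" for u u' v
    using dec_treesD(4)[OF T that noteq_r[OF childS[OF that(1)]]] .
  have fin_ch: "finite (children T u)" for u
    by (rule finite_subset[OF _ finS]) (auto simp: children_def childS)
  have ch2: "card (children T u) \<le> 2" if "u \<in> insert r S" for u
    using dec_treesD(5)[OF T that] .
  have rm: "(r, m) \<in> T"
  proof -
    obtain u where u: "(u, m) \<in> T" using parent[OF mS] by blast
    have "u \<notin> S" using lt[OF u] le_m[of u] by auto
    hence "u = r" using sub[OF u] by blast
    with u show ?thesis by simp
  qed
  have mA: "m \<in> A" by (simp add: A_def m_def)
  thus "Max S \<in> A" by (simp add: m_def)
  have AS: "A \<subseteq> S"
  proof
    fix v assume "v \<in> A"
    hence "(m, v) \<in> T\<^sup>*" by (simp add: A_def m_def)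
    thus "v \<in> S" by induction (use mS childS in auto)
  qed
  thus "A \<subseteq> S" .
  have down: "v \<in> A" if "u \<in> A" "(u, v) \<in> T" for u v
    using that unfolding A_def by (simp add: rtrancl_into_rtrancl)
  \<comment> \<open>The last edge of the path from \<open>m\<close> to \<open>v\<close> starts at
    the only parent of \<open>v\<close>, so that parent is itself a descendant of
    \<open>m\<close>.\<close>
  have up: "u \<in> A" if "v \<in> A" "v \<noteq> m" "(u, v) \<in> T" for u v
  proof -
    have "(m, v) \<in> T\<^sup>*" using \<open>v \<in> A\<close> by (simp add: A_def m_def)
    then obtain u' where u': "(m, u') \<in> T\<^sup>*" "(u', v) \<in> T"
      using \<open>v \<noteq> m\<close> by (auto elim: rtranclE)
    with unique[OF \<open>(u, v) \<in> T\<close>] show ?thesis by (auto simp: A_def m_def)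
  qed
  have finA: "finite A" and finB: "finite B" using AS finS by (auto simp: B_def intro: finite_subset)
  have MaxA: "Max A = m" using mA AS le_m finA by (intro Max_eqI) auto
  have rS: "r \<notin> S" using less_r by blast
  \<comment> \<open>The parent of \<open>Max B\<close> is not in \<open>A\<close>, which is closed
    under children, nor in \<open>B\<close>, as its label is too large; only \<open>r\<close>
    remains.\<close>
  have rB: "(r, Max B) \<in> T" "Max B \<in> B" if "B \<noteq> {}"
  proof -
    show MB: "Max B \<in> B" using finB that by simp
    then obtain u where u: "(u, Max B) \<in> T" using parent by (auto simp: B_def)
    have "u \<notin> A" using down[OF _ u] MB by (auto simp: B_def)
    moreover have "u \<notin> B" using lt[OF u] Max_ge[OF finB, of u] by auto
    ultimately have "u = r" using sub[OF u] by (auto simp: B_def)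
    with u show "(r, Max B) \<in> T" by simp
  qed
  \<comment> \<open>Otherwise \<open>m\<close>, \<open>Max B\<close> and \<open>v\<close> would be
    three distinct children of \<open>r\<close>.\<close>
  have r_child_B: "v = Max B" if "(r, v) \<in> T" "v \<in> B" for v
  proof (rule ccontr)
    assume "v \<noteq> Max B"
    moreover have "m \<noteq> Max B" "m \<noteq> v" using rB(2) mA that(2) by (auto simp: B_def)
    ultimately have "card {m, Max B, v} = 3" by simp
    moreover have "{m, Max B, v} \<subseteq> children T r"
      using rm rB(1) that by (auto simp: children_def)
    ultimately have "3 \<le> card (children T r)" using card_mono[OF fin_ch] by metis
    with ch2[of r] show False by simp
  qed
  have edge_A: "(u, v) \<in> T \<inter> A \<times> A" if "(u, v) \<in> T" "v \<in> A" "v \<noteq> m" for u v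
    using up[OF that(2,3,1)] that by blast
  have edge_B: "(u, v) \<in> T \<inter> B \<times> B" if "(u, v) \<in> T" "v \<in> B" "v \<noteq> Max B" for u v
  proof -
    have "u \<noteq> r" using r_child_B that by blast
    moreover have "u \<notin> A" using down[OF _ that(1)] that(2) by (auto simp: B_def)
    ultimately show ?thesis using sub[OF that(1)] that by (auto simp: B_def)
  qed
  have card_ch: "card (children (T \<inter> X \<times> X) u) \<le> 2" if "u \<in> insert r S" for u X
    using card_mono[OF fin_ch, of "children (T \<inter> X \<times> X) u" u] ch2[OF that]
    by (fastforce simp: children_def)
  show "T \<inter> A \<times> A \<in> dec_trees A"
    unfolding dec_trees_def mem_Collect_eq MaxA
  proof (intro conjI ballI impI)
    fix v assume v: "v \<in> A" "v \<noteq> m"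
    then obtain u where "(u, v) \<in> T" using parent AS by blast
    with v edge_A unique show "\<exists>!u. (u, v) \<in> T \<inter> A \<times> A" by blast
  qed (use lt AS card_ch in auto)
  show "T \<inter> B \<times> B \<in> dec_trees B"
    unfolding dec_trees_def mem_Collect_eq
  proof (intro conjI ballI impI)
    fix v assume v: "v \<in> B" "v \<noteq> Max B"
    then obtain u where "(u, v) \<in> T" using parent by (auto simp: B_def)
    with v edge_B unique show "\<exists>!u. (u, v) \<in> T \<inter> B \<times> B" by blast
  next
    fix u assume "u \<in> B"
    thus "card (children (T \<inter> B \<times> B) u) \<le> 2" by (intro card_ch) (auto simp: B_def)
  qed (use lt in auto)
  show "join_trees r A B (T \<inter> A \<times> A) (T \<inter> B \<times> B) = T"
  proof (intro equalityI subrelI)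
    fix u v assume "(u, v) \<in> join_trees r A B (T \<inter> A \<times> A) (T \<inter> B \<times> B)"
    thus "(u, v) \<in> T" using rm rB by (auto simp: join_trees_def mem_root_edge MaxA)
  next
    fix u v assume uv: "(u, v) \<in> T"
    consider "v = m" | "v \<in> A" "v \<noteq> m" | "v \<in> B" "v = Max B" | "v \<in> B" "v \<noteq> Max B"
      using childS[OF uv] by (auto simp: B_def)
    thus "(u, v) \<in> join_trees r A B (T \<inter> A \<times> A) (T \<inter> B \<times> B)"
    proof cases
      case 1
      hence "u = r" using unique[OF uv] rm by simp
      thus ?thesis using 1 mA by (auto simp: join_trees_def mem_root_edge MaxA)
    next
      case 2
      thus ?thesis using edge_A[OF uv] by (auto simp: join_trees_def)
    next
      case 3
      hence "u = r" using unique[OF uv] rB(1) by blast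
      thus ?thesis using 3 by (auto simp: join_trees_def mem_root_edge)
    next
      case 4
      thus ?thesis using edge_B[OF uv] by (auto simp: join_trees_def)
    qed
  qed
qed

text \<open>The weight is arbitrary so that the same decomposition serves both the number of trees
  (weight 1) and the total of rank 1 vertices.\<close>

lemma sum_dec_trees_insert:
  fixes \<phi> :: "(nat \<times> nat) set \<Rightarrow> 'b :: comm_monoid_add"
  assumes finS: "finite S" and less_r: "\<And>x. x \<in> S \<Longrightarrow> x < r" and ne: "S \<noteq> {}"
  shows "(\<Sum>T\<in>dec_trees (insert r S). \<phi> T) =
    (\<Sum>A | Max S \<in> A \<and> A \<subseteq> S. \<Sum>T1\<in>dec_trees A. \<Sum>T2\<in>dec_trees (S - A).
       \<phi> (join_trees r A (S - A) T1 T2))"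
proof -
  define \<A> where "\<A> = {A. Max S \<in> A \<and> A \<subseteq> S}"
  have fin: "finite \<A>" "\<forall>A\<in>\<A>. finite (dec_trees A \<times> dec_trees (S - A))"
    using finS by (auto simp: \<A>_def intro!: finite_dec_trees intro: finite_subset)
  have tj: "tree_join r A (S - A) T1 T2"
    if "A \<in> \<A>" "T1 \<in> dec_trees A" "T2 \<in> dec_trees (S - A)" for A T1 T2
    using that finS less_r by unfold_locales (auto simp: \<A>_def intro: finite_subset)
  define desc where "desc = (\<lambda>T. {v. (Max S, v) \<in> T\<^sup>*})"
  have "(\<Sum>T\<in>dec_trees (insert r S). \<phi> T) =
     (\<Sum>(A, T1, T2)\<in>(SIGMA A:\<A>. dec_trees A \<times> dec_trees (S - A)). \<phi> (join_trees r A (S - A) T1 T2))"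
  proof (rule sum.reindex_bij_witness[where
        j = "\<lambda>T. (desc T, T \<inter> desc T \<times> desc T, T \<inter> (S - desc T) \<times> (S - desc T))" and
        i = "\<lambda>(A, T1, T2). join_trees r A (S - A) T1 T2"])
    fix T assume T: "T \<in> dec_trees (insert r S)"
    note split = dec_trees_split[OF finS less_r ne T, folded desc_def]
    show "(case (desc T, T \<inter> desc T \<times> desc T, T \<inter> (S - desc T) \<times> (S - desc T)) of
        (A, T1, T2) \<Rightarrow> join_trees r A (S - A) T1 T2) = T"
      using split(5) by (simp add: desc_def)
    show "(desc T, T \<inter> desc T \<times> desc T, T \<inter> (S - desc T) \<times> (S - desc T)) \<in>
        (SIGMA A:\<A>. dec_trees A \<times> dec_trees (S - A))"
      using split(1-4) by (simp add: desc_def \<A>_def)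
    show "(case (desc T, T \<inter> desc T \<times> desc T, T \<inter> (S - desc T) \<times> (S - desc T)) of
        (A, T1, T2) \<Rightarrow> \<phi> (join_trees r A (S - A) T1 T2)) = \<phi> T"
      using split(5) by (simp add: desc_def)
  next
    fix x assume "x \<in> (SIGMA A:\<A>. dec_trees A \<times> dec_trees (S - A))"
    then obtain A T1 T2 where x: "x = (A, T1, T2)" and A: "A \<in> \<A>"
      and T: "T1 \<in> dec_trees A" "T2 \<in> dec_trees (S - A)" by auto
    interpret tree_join r A "S - A" T1 T2 by (rule tj[OF A T])
    have un: "A \<union> (S - A) = S" and neA: "A \<noteq> {}" using A by (auto simp: \<A>_def)
    have MA: "Max A = Max S"
      using A finS finite_subset by (intro Max_eqI) (auto simp: \<A>_def)
    have d: "desc J = A" using descendants_join[OF neA] by (simp add: desc_def MA)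
    show "(\<lambda>T. (desc T, T \<inter> desc T \<times> desc T, T \<inter> (S - desc T) \<times> (S - desc T)))
       (case x of (A, T1, T2) \<Rightarrow> join_trees r A (S - A) T1 T2) = x"
      unfolding x prod.case d restrict_join ..
    show "(case x of (A, T1, T2) \<Rightarrow> join_trees r A (S - A) T1 T2) \<in> dec_trees (insert r S)"
      using join_in_dec_trees unfolding x prod.case un .
  qed
  also have "\<dots> = (\<Sum>A\<in>\<A>. \<Sum>(T1, T2)\<in>dec_trees A \<times> dec_trees (S - A). \<phi> (join_trees r A (S - A) T1 T2))"
    using sum.Sigma[OF fin, of "\<lambda>A (T1, T2). \<phi> (join_trees r A (S - A) T1 T2)"]
    by (simp add: case_prod_unfold)
  finally show ?thesis by (simp add: sum.cartesian_product \<A>_def)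
qed

section \<open>Sums over label sets and products of exponential generating functions\<close>

text \<open>Complementation exchanges the subsets that contain \<open>m\<close> with those that do
  not. For symmetric weights this removes the distinguished label at the cost of a factor 2.\<close>

lemma sum_subsets_containing:
  fixes \<phi> :: "'a set \<Rightarrow> 'b :: comm_semiring_1"
  assumes "finite S" and "m \<in> S" and sym: "\<And>A. A \<subseteq> S \<Longrightarrow> \<phi> (S - A) = \<phi> A"
  shows "2 * (\<Sum>A | m \<in> A \<and> A \<subseteq> S. \<phi> A) = (\<Sum>A\<in>Pow S. \<phi> A)"
proof -
  have "(\<Sum>A | m \<in> A \<and> A \<subseteq> S. \<phi> A) = (\<Sum>A | m \<notin> A \<and> A \<subseteq> S. \<phi> A)"
    by (rule sum.reindex_bij_witness[where i = "\<lambda>A. S - A" and j = "\<lambda>A. S - A"])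
       (use assms in \<open>auto simp: double_diff\<close>)
  hence "2 * (\<Sum>A | m \<in> A \<and> A \<subseteq> S. \<phi> A) =
     (\<Sum>A | m \<in> A \<and> A \<subseteq> S. \<phi> A) + (\<Sum>A | m \<notin> A \<and> A \<subseteq> S. \<phi> A)" by (simp add: mult_2)
  also have "\<dots> = (\<Sum>A\<in>{A. m \<in> A \<and> A \<subseteq> S} \<union> {A. m \<notin> A \<and> A \<subseteq> S}. \<phi> A)"
    using assms(1) by (intro sum.union_disjoint[symmetric]) auto
  also have "{A. m \<in> A \<and> A \<subseteq> S} \<union> {A. m \<notin> A \<and> A \<subseteq> S} = Pow S" by auto
  finally show ?thesis .
qed

text \<open>The binomial number of subsets of size k cancels the factorials of k and n - k, leaving
  \<open>fact n\<close> times a Cauchy product.\<close>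

lemma sum_Pow_egf:
  fixes f g :: "'a :: field_char_0 fps"
  assumes "finite S"
  shows "(\<Sum>A\<in>Pow S. (fact (card A) * f $ card A) * (fact (card (S - A)) * g $ card (S - A)))
       = fact (card S) * (f * g) $ card S"
proof -
  define n where "n = card S"
  define h where "h = (\<lambda>k. (fact k * f $ k) * (fact (n - k) * g $ (n - k)))"
  have "(\<Sum>A\<in>Pow S. (fact (card A) * f $ card A) * (fact (card (S - A)) * g $ card (S - A)))
      = (\<Sum>A\<in>Pow S. h (card A))"
    using assms by (intro sum.cong refl) (auto simp: h_def n_def card_Diff_subset finite_subset)
  also have "\<dots> = (\<Sum>k\<in>{0..n}. \<Sum>A | A \<in> Pow S \<and> card A = k. h (card A))"
    using assms by (intro sum.group[symmetric]) (auto simp: n_def card_mono)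
  also have "\<dots> = (\<Sum>k\<in>{0..n}. of_nat (n choose k) * h k)"
    using assms by (intro sum.cong refl) (simp add: n_def n_subsets)
  also have "\<dots> = (\<Sum>k\<in>{0..n}. fact n * (f $ k * g $ (n - k)))"
    by (intro sum.cong refl) (simp add: h_def binomial_fact)
  finally show ?thesis by (simp add: fps_mult_nth sum_distrib_left n_def)
qed

section \<open>Formal differential equations for the two series\<close>

text \<open>The coefficients are complex so that the series can be compared with Taylor expansions
  of holomorphic functions.\<close>

definition sec_tan_fps :: "complex fps" where
  "sec_tan_fps = (1 + fps_sin 1) * inverse (fps_cos 1)"

lemma sec_tan_fps_mult_cos: "sec_tan_fps * fps_cos 1 = 1 + fps_sin 1"
  unfolding sec_tan_fps_def by (simp add: mult.assoc inverse_mult_eq_1)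

lemma fps_cos_1_nonzero: "fps_cos 1 \<noteq> (0 :: complex fps)"
  by (metis fps_cos_nth_0 fps_zero_nth zero_neq_one)

lemma fps_sin_cos_1_squares: "fps_sin 1 * fps_sin 1 = 1 - fps_cos 1 * (fps_cos 1 :: complex fps)"
  using fps_sin_cos_sum_of_squares[of "1::complex"] by (simp add: power2_eq_square algebra_simps)

lemma sec_tan_fps_mult_1_minus_sin: "sec_tan_fps * (1 - fps_sin 1) = fps_cos 1"
proof -
  have "fps_cos 1 * (sec_tan_fps * (1 - fps_sin 1)) = (sec_tan_fps * fps_cos 1) * (1 - fps_sin 1)"
    by (simp add: algebra_simps)
  also have "\<dots> = fps_cos 1 * fps_cos 1"
    unfolding sec_tan_fps_mult_cos using fps_sin_cos_1_squares by (simp add: algebra_simps)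
  finally show ?thesis using fps_cos_1_nonzero by simp
qed

text \<open>This says 1/Y' = 1 - sin z. It follows by differentiating Y cos z = 1 + sin z,
  multiplying by 1 - sin z and cancelling cos z.\<close>

lemma fps_deriv_sec_tan_mult_1_minus_sin: "fps_deriv sec_tan_fps * (1 - fps_sin 1) = 1"
proof -
  have "fps_deriv (sec_tan_fps * fps_cos 1) = fps_deriv (1 + fps_sin 1)"
    by (simp only: sec_tan_fps_mult_cos)
  hence d: "fps_deriv sec_tan_fps * fps_cos 1 = fps_cos 1 + sec_tan_fps * fps_sin 1"
    by (simp add: fps_sin_deriv fps_cos_deriv algebra_simps flip: fps_const_neg)
  have "fps_cos 1 * (fps_deriv sec_tan_fps * (1 - fps_sin 1))
      = (fps_deriv sec_tan_fps * fps_cos 1) * (1 - fps_sin 1)"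
    by (simp add: algebra_simps)
  also have "\<dots> = fps_cos 1 * (1 - fps_sin 1) + sec_tan_fps * (1 - fps_sin 1) * fps_sin 1"
    unfolding d by (simp add: algebra_simps)
  also have "\<dots> = fps_cos 1"
    unfolding sec_tan_fps_mult_1_minus_sin by (simp add: algebra_simps)
  finally show ?thesis using fps_cos_1_nonzero by simp
qed

lemma sec_tan_fps_nth_0: "sec_tan_fps $ 0 = 1"
  by (simp add: sec_tan_fps_def)

lemma fps_1_minus_sin_nonzero: "1 - fps_sin 1 \<noteq> (0 :: complex fps)"
  using fps_deriv_sec_tan_mult_1_minus_sin by force

lemma fps_deriv_sec_tan_mult_cos: "fps_deriv sec_tan_fps * fps_cos 1 = sec_tan_fps"
  using fps_deriv_sec_tan_mult_1_minus_sin sec_tan_fps_mult_1_minus_sin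
  by (metis mult.assoc mult.commute mult.right_neutral)

text \<open>Multiplied by the nonzero series 1 - sin z, both sides become 2; on the right this is (1
  - sin z) + (1 + sin z), because Y^2 (1 - sin z) = Y cos z.\<close>

lemma sec_tan_fps_riccati: "2 * fps_deriv sec_tan_fps = 1 + sec_tan_fps * sec_tan_fps"
proof -
  have "(1 - fps_sin 1) * (2 * fps_deriv sec_tan_fps)
      = 2 * (fps_deriv sec_tan_fps * (1 - fps_sin 1))"
    by (simp only: mult_ac)
  also have "\<dots> = (1 - fps_sin 1) + (1 + fps_sin 1)"
    unfolding fps_deriv_sec_tan_mult_1_minus_sin by simp
  also have "\<dots> = (1 - fps_sin 1) * 1 + sec_tan_fps * (sec_tan_fps * (1 - fps_sin 1))"
    unfolding sec_tan_fps_mult_1_minus_sin by (simp add: sec_tan_fps_mult_cos)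
  also have "\<dots> = (1 - fps_sin 1) * (1 + sec_tan_fps * sec_tan_fps)"
    by (simp add: algebra_simps)
  finally show ?thesis using fps_1_minus_sin_nonzero by simp
qed

(* F(z) is the integral from 0 to z of t cos t - (t^2/2) (1 - sin t). *)
definition rank1_factor_fps :: "complex fps" where
  "rank1_factor_fps = 2 * fps_X * fps_sin 1 + 2 * fps_cos 1 - 2
     - fps_const (1/6) * fps_X ^ 3 - fps_const (1/2) * fps_X ^ 2 * fps_cos 1"

text \<open>Only a candidate at this point: its link with rank 1 vertices is established in
  \<open>dec_trees_egf\<close>.\<close>

definition rank1_fps :: "complex fps" where
  "rank1_fps = rank1_factor_fps * fps_deriv sec_tan_fps"

lemma rank1_factor_fps_deriv:
  "2 * fps_deriv rank1_factor_fps = 2 * fps_X * fps_cos 1 - fps_X ^ 2 * (1 - fps_sin 1)"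
proof -
  have c: "fps_const (1/6) * (3 * z) = (fps_const (1/2) * z :: complex fps)"
     "2 * fps_const (1/2) = (1 :: complex fps)" "4 * fps_const (1/2) = (2 :: complex fps)" for z
    by (simp_all add: numeral_fps_const mult.assoc[symmetric])
  show ?thesis
  unfolding rank1_factor_fps_def
  by (simp add: fps_deriv_power fps_sin_deriv fps_cos_deriv algebra_simps c power2_eq_square
        flip: fps_const_neg)
qed

text \<open>Product rule: differentiating the Riccati equation gives Y'' = Y Y', so F Y'' = A Y, and
  the rest is F' Y' with Y' cos z = Y and Y' (1 - sin z) = 1.\<close>

lemma rank1_fps_deriv:
  "2 * fps_deriv rank1_fps = 2 * rank1_fps * sec_tan_fps + 2 * fps_X * sec_tan_fps - fps_X ^ 2"
proof -
  have "2 * fps_deriv (fps_deriv sec_tan_fps) = fps_deriv (2 * fps_deriv sec_tan_fps)"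
    by simp
  also have "\<dots> = 2 * (sec_tan_fps * fps_deriv sec_tan_fps)"
    unfolding sec_tan_fps_riccati by simp
  finally have dd: "fps_deriv (fps_deriv sec_tan_fps) = sec_tan_fps * fps_deriv sec_tan_fps"
    by simp
  have "2 * fps_deriv rank1_fps = 2 * rank1_fps * sec_tan_fps
         + (2 * fps_deriv rank1_factor_fps) * fps_deriv sec_tan_fps"
    unfolding rank1_fps_def by (simp add: dd algebra_simps)
  also have "(2 * fps_deriv rank1_factor_fps) * fps_deriv sec_tan_fps
       = 2 * fps_X * (fps_deriv sec_tan_fps * fps_cos 1)
          - fps_X ^ 2 * (fps_deriv sec_tan_fps * (1 - fps_sin 1))"
    unfolding rank1_factor_fps_deriv by (simp add: algebra_simps)
  finally show ?thesis
    unfolding fps_deriv_sec_tan_mult_cos fps_deriv_sec_tan_mult_1_minus_sin by (simp add: algebra_simps)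
qed

lemma rank1_fps_nth_0: "rank1_fps $ 0 = 0"
  by (simp add: rank1_fps_def rank1_factor_fps_def)

section \<open>The pole of sec z + tan z at pi/2 and the growth of its coefficients\<close>

definition csinc :: "complex \<Rightarrow> complex" where
  "csinc z = (if z = 0 then 1 else sin z / z)"

lemma holomorphic_csinc: "csinc holomorphic_on UNIV"
proof (rule no_isolated_singularity)
  have "isCont csinc z" for z
  proof (cases "z = 0")
    case True
    then show ?thesis
      using DERIV_isCont[OF has_field_derivative_sin_z_over_z[of "UNIV :: complex set"]]
      by (simp add: csinc_def[abs_def])
  next
    case False
    hence "eventually (\<lambda>w. csinc w = sin w / w) (nhds z)"
      using t1_space_nhds[of z 0] by (auto elim!: eventually_mono simp: csinc_def)
    with False show ?thesis by (subst isCont_cong) (auto intro!: continuous_intros)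
  qed
  thus "continuous_on UNIV csinc" by (simp add: continuous_at_imp_continuous_on)
  have "(\<lambda>z. sin z / z) holomorphic_on UNIV - {0}" by (auto intro!: holomorphic_intros)
  thus "csinc holomorphic_on UNIV - {0}"
    by (rule holomorphic_transform) (auto simp: csinc_def)
qed auto

lemma csinc_nonzero: "norm z < pi \<Longrightarrow> csinc z \<noteq> 0"
proof
  assume z: "norm z < pi" and "csinc z = 0"
  hence nz: "z \<noteq> 0" and "sin z = 0" by (auto simp: csinc_def split: if_splits)
  then obtain n :: int where n: "z = of_real (n * pi)" by (auto simp: sin_eq_0)
  hence "\<bar>real_of_int n\<bar> * pi < 1 * pi" using z by (simp add: abs_mult norm_mult)
  hence "\<bar>real_of_int n\<bar> < 1" by (subst (asm) mult_less_cancel_right) auto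
  hence "n = 0" by linarith
  with n nz show False by simp
qed

(* This is (pi/2 - z) (sec z + tan z) with the pole at pi/2 removed: since
   sec z + tan z = cot w for w = pi/4 - z/2, it equals 2 w cot w. *)
definition sec_tan_reg :: "complex \<Rightarrow> complex" where
  "sec_tan_reg z = 2 * cos (of_real pi/4 - z/2) / csinc (of_real pi/4 - z/2)"

text \<open>Origin of the radius 3 pi/2: for w = pi/4 - z/2, the next zero w = pi of the sine
  corresponds to z = -3 pi/2.\<close>

lemma norm_quarter: "norm z < 3*pi/2 \<Longrightarrow> norm (complex_of_real pi/4 - z/2) < pi"
proof -
  assume "norm z < 3*pi/2"
  moreover have "norm (complex_of_real pi/4 - z/2) \<le> norm (complex_of_real pi/4) + norm (z/2)"
    by (rule norm_triangle_ineq4)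
  ultimately show ?thesis by (simp add: norm_divide)
qed

lemma holomorphic_sec_tan_reg: "sec_tan_reg holomorphic_on ball 0 (3*pi/2)"
proof -
  have "(\<lambda>z. csinc (pi/4 - z/2)) holomorphic_on ball 0 (3*pi/2)"
    by (rule holomorphic_on_compose_gen[OF _ holomorphic_csinc, unfolded o_def])
       (auto intro!: holomorphic_intros)
  thus ?thesis unfolding sec_tan_reg_def[abs_def]
    by (intro holomorphic_intros) (auto intro!: csinc_nonzero norm_quarter)
qed

text \<open>With z = pi/2 - 2 w, cos z = 2 sin w cos w and 1 + sin z = 2 cos^2 w. The disc keeps w
  away from 0, and any neighbourhood of 0 suffices for comparing expansions there.\<close>

lemma sec_tan_reg_mult_cos:
  assumes "norm z < pi/2"
  shows "sec_tan_reg z * cos z = (of_real (pi/2) - z) * (1 + sin z)"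
proof -
  define w where "w = of_real pi/4 - z/2"
  have z: "z = of_real pi/2 - 2 * w" by (simp add: w_def field_simps)
  have w0: "w \<noteq> 0"
  proof
    assume "w = 0"
    hence "norm z = pi/2" by (simp add: z)
    with assms show False by simp
  qed
  have "norm w < pi" unfolding w_def by (rule norm_quarter) (use assms pi_gt_zero in linarith)
  hence s: "sin w \<noteq> 0" using csinc_nonzero[of w] w0 by (auto simp: csinc_def)
  have half_pi: "cos (complex_of_real pi / 2) = 0" "sin (complex_of_real pi / 2) = 1"
    using cos_of_real[of "pi/2", where ?'a = complex] sin_of_real[of "pi/2", where ?'a = complex]
    by simp_all
  have c: "cos z = 2 * sin w * cos w"
    unfolding z by (simp add: cos_diff sin_double half_pi)
  have "sin z = cos (2 * w)"
    unfolding z by (simp add: sin_diff half_pi)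
  hence s2: "1 + sin z = 2 * cos w ^ 2" by (simp add: cos_double_cos)
  have "sec_tan_reg z = 2 * cos w / (sin w / w)"
    using w0 by (simp add: sec_tan_reg_def w_def csinc_def)
  moreover have "of_real (pi/2) - z = 2 * w" by (simp add: z)
  ultimately show ?thesis unfolding c s2 using s w0 by (simp add: power2_eq_square)
qed

lemma sec_tan_reg_half_pi: "sec_tan_reg (pi/2) = 2"
  by (simp add: sec_tan_reg_def csinc_def)

text \<open>After multiplication by the cosine both sides expand the same function at 0, and the
  nonzero series \<open>fps_cos 1\<close> can be cancelled.\<close>

lemma sec_tan_reg_fps: "sec_tan_reg has_fps_expansion (fps_const (of_real (pi/2)) - fps_X) * sec_tan_fps"
proof -
  define h where "h = fps_expansion sec_tan_reg 0"
  have h: "sec_tan_reg has_fps_expansion h"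
    unfolding h_def by (rule has_fps_expansion_fps_expansion[OF _ _ holomorphic_sec_tan_reg]) auto
  have "(\<lambda>z. sec_tan_reg z * cos z) has_fps_expansion h * fps_cos 1"
    by (intro fps_expansion_intros h)
  moreover have "eventually (\<lambda>z. sec_tan_reg z * cos z = (of_real (pi/2) - z) * (1 + sin z)) (nhds 0)"
  proof -
    have "eventually (\<lambda>z. z \<in> ball (0::complex) (pi/2)) (nhds 0)"
      by (rule eventually_nhds_in_open) auto
    thus ?thesis by eventually_elim (rule sec_tan_reg_mult_cos, simp)
  qed
  ultimately have "(\<lambda>z::complex. (of_real (pi/2) - z) * (1 + sin z)) has_fps_expansion h * fps_cos 1"
    by (subst (asm) has_fps_expansion_cong) (auto elim: eventually_mono)
  moreover have "(\<lambda>z::complex. (of_real (pi/2) - z) * (1 + sin z)) has_fps_expansion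
      (fps_const (of_real (pi/2)) - fps_X) * (1 + fps_sin 1)"
    by (intro fps_expansion_intros)
  ultimately have "h * fps_cos 1 = (fps_const (of_real (pi/2)) - fps_X) * (1 + fps_sin 1)"
    by (rule fps_expansion_unique_complex)
  also have "\<dots> = (fps_const (of_real (pi/2)) - fps_X) * sec_tan_fps * fps_cos 1"
    by (simp only: sec_tan_fps_mult_cos[symmetric] mult.assoc)
  finally have "h = (fps_const (of_real (pi/2)) - fps_X) * sec_tan_fps"
    using fps_cos_1_nonzero by simp
  with h show ?thesis by simp
qed

text \<open>Multiplying by pi/2 - z makes the series telescope: the partial sums of the product at
  pi/2 are exactly the scaled coefficients of Y. They converge to \<open>sec_tan_reg (pi/2)\<close>,
  as pi/2 lies inside the disc of radius 3 pi/2.\<close>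

lemma sec_tan_fps_asymptotics:
  "(\<lambda>n. sec_tan_fps $ n * of_real (pi/2) ^ Suc n) \<longlonglongrightarrow> 2"
proof -
  define h where "h = (fps_const (of_real (pi/2)) - fps_X) * sec_tan_fps"
  have "(\<lambda>n. h $ n * of_real (pi/2) ^ n) sums sec_tan_reg (of_real (pi/2))"
    unfolding h_def
    by (rule has_fps_expansion_imp_sums_complex[OF sec_tan_reg_fps, of "ereal (3*pi/2)"])
       (use holomorphic_sec_tan_reg in auto)
  hence "(\<lambda>n. \<Sum>k<Suc n. h $ k * of_real (pi/2) ^ k) \<longlonglongrightarrow> sec_tan_reg (of_real (pi/2))"
    unfolding sums_def by (rule LIMSEQ_Suc)
  moreover have "(\<Sum>k<Suc n. h $ k * of_real (pi/2) ^ k) = sec_tan_fps $ n * of_real (pi/2) ^ Suc n" for n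
  proof (induction n)
    case 0
    show ?case by (simp add: h_def)
  next
    case (Suc n)
    have "h $ Suc n = of_real (pi/2) * sec_tan_fps $ Suc n - sec_tan_fps $ n"
      by (simp add: h_def ring_distribs)
    hence *: "h $ Suc n * of_real (pi/2) ^ Suc n
        = of_real (pi/2) * sec_tan_fps $ Suc n * of_real (pi/2) ^ Suc n - sec_tan_fps $ n * of_real (pi/2) ^ Suc n"
      by (simp only: left_diff_distrib)
    show ?case
      by (subst sum.lessThan_Suc, subst Suc.IH, subst *) (simp add: mult_ac)
  qed
  ultimately show ?thesis using sec_tan_reg_half_pi by (simp only: of_real_divide of_real_numeral)
qed

section \<open>The limit of the coefficient ratio and its numerical value\<close>

lemma rank1_factor_fps_sums:
  "(\<lambda>n. rank1_factor_fps $ n * of_real (pi/2) ^ n) sums of_real (pi - 2 - pi^3/48)"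
proof -
  define f :: "complex \<Rightarrow> complex" where
    "f = (\<lambda>z. 2 * z * sin z + 2 * cos z - 2 - (1/6) * z ^ 3 - (1/2) * z ^ 2 * cos z)"
  have "f has_fps_expansion rank1_factor_fps"
    unfolding f_def rank1_factor_fps_def by (intro fps_expansion_intros)
  moreover have "f holomorphic_on eball 0 \<infinity>"
    unfolding f_def by (intro holomorphic_intros)
  ultimately have "(\<lambda>n. rank1_factor_fps $ n * of_real (pi/2) ^ n) sums f (of_real (pi/2))"
    by (rule has_fps_expansion_imp_sums_complex) simp
  moreover have "f (of_real (pi/2)) = of_real (pi - 2 - pi^3/48)"
    unfolding f_def sin_of_real cos_of_real by (simp add: field_simps power3_eq_cube)
  ultimately show ?thesis by simp
qed

text \<open>Absolute convergence at pi/2 supplies the summable majorant for Tannery's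
  theorem.\<close>

lemma rank1_factor_fps_norm_summable:
  "summable (\<lambda>n. norm (rank1_factor_fps $ n * of_real (pi/2) ^ n))"
proof -
  have "(\<lambda>z::complex. 2 * z * sin z + 2 * cos z - 2 - (1/6) * z ^ 3 - (1/2) * z ^ 2 * cos z)
         has_fps_expansion rank1_factor_fps"
    unfolding rank1_factor_fps_def by (intro fps_expansion_intros)
  hence "fps_conv_radius rank1_factor_fps \<ge> \<infinity>"
    by (rule holomorphic_on_imp_fps_conv_radius_ge) (intro holomorphic_intros)
  thus ?thesis by (intro norm_summable_fps) auto
qed


lemma rank1_fps_sec_tan_fps_ratio:
  "(\<lambda>n. rank1_fps $ n / (of_nat (n + 1) * sec_tan_fps $ n)) \<longlonglongrightarrow> of_real (2 - pi\<^sup>2 / 24 - 4 / pi)"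
proof -
  define c :: complex where "c = of_real (pi/2)"
  have c0: "c \<noteq> 0" by (simp add: c_def)
  define b where "b = (\<lambda>n. sec_tan_fps $ n * c ^ Suc n)"
  define f where "f = (\<lambda>k. rank1_factor_fps $ k * c ^ k)"
  \<comment> \<open>The k-th term of the Cauchy product for coefficient n of F Y', scaled by
    \<open>c ^ (n + 2) / of_nat (n + 1)\<close>. Coefficient n - k of Y' is n + 1 - k times
    coefficient n + 1 - k of Y, so the middle quotient is at most 1 and tends to 1.\<close>
  define a where "a = (\<lambda>k n. if k \<le> n then f k * (of_nat (n + 1 - k) / of_nat (n + 1)) * b (n + 1 - k) else 0)"
  have b: "b \<longlonglongrightarrow> 2" using sec_tan_fps_asymptotics by (simp add: b_def c_def)
  hence "Bseq b" by (intro convergent_imp_Bseq convergentI)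
  then obtain K where K: "K > 0" "\<And>n. norm (b n) \<le> K" by (auto elim: BseqE)
  have lim: "(\<lambda>n. suminf (\<lambda>k. a k n)) \<longlonglongrightarrow> suminf (\<lambda>k. f k * 2)"
  proof (rule tannerys_theorem[THEN conjunct2, THEN conjunct2])
    show "(\<lambda>n. a k n) \<longlonglongrightarrow> f k * 2" for k
    proof -
      have "(\<lambda>n. real (n + 1 - k) / real (n + 1)) \<longlonglongrightarrow> 1"
      proof (rule Lim_transform_eventually)
        have "(\<lambda>n. 1 - real k * inverse (real (Suc n))) \<longlonglongrightarrow> 1 - real k * 0"
          by (intro tendsto_intros LIMSEQ_inverse_real_of_nat)
        thus "(\<lambda>n. 1 - real k / real (n + 1)) \<longlonglongrightarrow> 1" by (simp add: field_simps)
        show "\<forall>\<^sub>F n in sequentially. 1 - real k / real (n + 1) = real (n + 1 - k) / real (n + 1)"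
          using eventually_ge_at_top[of k] by eventually_elim (simp add: of_nat_diff field_simps)
      qed
      from tendsto_of_real[OF this, where ?'a = complex]
      have 1: "(\<lambda>n. of_nat (n + 1 - k) / of_nat (n + 1) :: complex) \<longlonglongrightarrow> 1" by simp
      have "(\<lambda>n. b (n + 1 - k)) \<longlonglongrightarrow> 2"
        by (rule LIMSEQ_offset[of _ k]) (use LIMSEQ_Suc[OF b] in simp)
      hence "(\<lambda>n. f k * (of_nat (n + 1 - k) / of_nat (n + 1)) * b (n + 1 - k)) \<longlonglongrightarrow> f k * 1 * 2"
        by (intro tendsto_intros 1)
      thus ?thesis
        unfolding mult_1_right
      proof (rule Lim_transform_eventually)
        show "\<forall>\<^sub>F n in sequentially. f k * (of_nat (n + 1 - k) / of_nat (n + 1)) * b (n + 1 - k) = a k n"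
          using eventually_ge_at_top[of k] by eventually_elim (simp add: a_def)
      qed
    qed
    have "norm (a k n) \<le> norm (f k) * K" for k n
    proof -
      have "norm (f k) * (real (n + 1 - k) / real (n + 1)) * norm (b (n + 1 - k)) \<le> norm (f k) * 1 * K"
        using K by (intro mult_mono mult_left_mono) (auto simp: divide_simps)
      moreover have "norm (of_nat (n + 1 - k) / of_nat (n + 1) :: complex) = real (n + 1 - k) / real (n + 1)"
        by (simp only: norm_divide norm_of_nat)
      ultimately have "norm (f k * (of_nat (n + 1 - k) / of_nat (n + 1)) * b (n + 1 - k)) \<le> norm (f k) * K"
        by (simp only: norm_mult mult_1_right)
      thus ?thesis using K(1) by (auto simp: a_def)
    qed
    thus "\<forall>\<^sub>F (k, n) in at_top \<times>\<^sub>F sequentially. norm (a k n) \<le> norm (f k) * K"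
      by (auto intro!: always_eventually)
    show "summable (\<lambda>k. norm (f k) * K)"
      unfolding f_def c_def by (intro summable_mult2 rank1_factor_fps_norm_summable)
  qed simp
  have S: "suminf (\<lambda>k. f k * 2) = of_real (pi - 2 - pi^3/48) * 2"
    using sums_mult2[OF rank1_factor_fps_sums, of 2] by (simp add: sums_iff f_def c_def)
  have A: "suminf (\<lambda>k. a k n) = rank1_fps $ n * c ^ (n + 2) / of_nat (n + 1)" for n
  proof -
    have "suminf (\<lambda>k. a k n) = (\<Sum>k\<in>{0..n}. a k n)"
      by (rule suminf_finite) (auto simp: a_def)
    also have "\<dots> = (\<Sum>k\<in>{0..n}. rank1_factor_fps $ k * fps_deriv sec_tan_fps $ (n - k) * (c ^ (n + 2) / of_nat (n + 1)))"
    proof (intro sum.cong refl)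
      fix k assume k: "k \<in> {0..n}"
      have e: "n + 1 - k = Suc (n - k)" "c ^ (n + 2) = c ^ k * c ^ Suc (Suc (n - k))"
        using k by (auto simp flip: power_add)
      show "a k n = rank1_factor_fps $ k * fps_deriv sec_tan_fps $ (n - k) * (c ^ (n + 2) / of_nat (n + 1))"
        using k unfolding a_def f_def b_def e by simp
    qed
    also have "\<dots> = rank1_fps $ n * (c ^ (n + 2) / of_nat (n + 1))"
      by (simp only: rank1_fps_def fps_mult_nth sum_distrib_right)
    finally show ?thesis by simp
  qed
  \<comment> \<open>The divisor \<open>c * b n\<close> carries the same power
    \<open>c ^ (n + 2)\<close>, which cancels; its extra \<open>c\<close> is the source of the
    factor 2/pi.\<close>
  have "(\<lambda>n. suminf (\<lambda>k. a k n) / (c * b n)) \<longlonglongrightarrow> of_real (pi - 2 - pi^3/48) * 2 / (c * 2)"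
    using lim unfolding S by (intro tendsto_intros b) (use c0 in auto)
  also have "(\<lambda>n. suminf (\<lambda>k. a k n) / (c * b n)) = (\<lambda>n. rank1_fps $ n / (of_nat (n + 1) * sec_tan_fps $ n))"
    unfolding A b_def using c0 by (auto simp: fun_eq_iff)
  also have "of_real (pi - 2 - pi^3/48) * 2 / (c * 2) = of_real ((pi - 2 - pi^3/48) / (pi / 2))"
    by (simp add: c_def)
  also have "(pi - 2 - pi^3/48) / (pi / 2) = 2 - pi\<^sup>2 / 24 - 4 / pi"
    by (simp add: field_simps power2_eq_square power3_eq_cube)
  finally show ?thesis .
qed

text \<open>The exact value is 0.31552693855..., about 5.5 / 10^10 below the stated decimal, so half
  a unit in the last digit would be too small a tolerance.\<close>

lemma rank1_constant_bounds: "\<bar>(2 - pi\<^sup>2 / 24 - 4 / pi) - 0.3155269391\<bar> < 1 / 10 ^ 9"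
proof -
  have "3.141592653588^2 \<le> pi\<^sup>2" "pi\<^sup>2 \<le> 3.1415926535899^2"
    using pi_approx by (auto intro!: power_mono)
  moreover have "4 / 3.1415926535899 \<le> 4 / pi" "4 / pi \<le> 4 / 3.141592653588"
    using pi_approx by (intro divide_left_mono; simp)+
  ultimately show ?thesis by (simp add: power2_eq_square abs_less_iff)
qed

section \<open>The counts as coefficients\<close>

lemma fps_X_nth_egf: "fact k * fps_X $ k = (of_bool (k = 1) :: 'a :: semiring_char_0)"
  by (cases "k = 1") auto

text \<open>The induction runs over finite sets rather than over n because subtrees carry arbitrary
  subsets of the labels. The second claim needs the first, as each subtree's total is weighted by
  the number of trees on the other side.\<close>

lemma dec_trees_egf:
  assumes "finite S"
  shows "of_nat (card (dec_trees S)) = fact (card S) * sec_tan_fps $ card S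
    \<and> (\<Sum>T\<in>dec_trees S. of_nat (card (rank1_vertices T))) = fact (card S) * rank1_fps $ card S"
  using assms
proof (induction S rule: finite_psubset_induct)
  case (psubset U)
  define N where "N = (\<lambda>S. of_nat (card (dec_trees S)) :: complex)"
  define R where "R = (\<lambda>S. \<Sum>T\<in>dec_trees S. of_nat (card (rank1_vertices T)) :: complex)"
  \<comment> \<open>Coefficients for a single vertex: the splitting needs a second largest label, so
    label sets of size 0 and 1 are base cases.\<close>
  have Y1: "sec_tan_fps $ 1 = 1"
    using arg_cong[OF sec_tan_fps_riccati, of "\<lambda>F. F $ 0"]
    by (simp add: sec_tan_fps_nth_0 fps_mult_nth)
  have A1: "rank1_fps $ 1 = 0"
    using arg_cong[OF rank1_fps_deriv, of "\<lambda>F. F $ 0"]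
    by (simp add: rank1_fps_nth_0 power2_eq_square fps_mult_nth)
  show ?case
  proof (cases "U = {}")
    case True
    thus ?thesis
      by (simp add: dec_trees_empty sec_tan_fps_nth_0 rank1_fps_nth_0 rank1_vertices_def)
  next
    case False
    define r where "r = Max U"
    define S where "S = U - {r}"
    have U: "U = insert r S" and rS: "r \<notin> S" and finS: "finite S"
      using Max_in[OF psubset.hyps(1) False] psubset.hyps(1) by (auto simp: S_def r_def)
    have less_r: "x < r" if "x \<in> S" for x
      using that psubset.hyps by (auto simp: S_def r_def intro: le_neq_trans)
    show ?thesis
    proof (cases "S = {}")
      case True
      thus ?thesis unfolding U
        using Y1 A1 by (simp add: dec_trees_singleton rank1_vertices_def)
    next
      case ne: False
      define n where "n = card S"
      have n: "n > 0" and cU: "card U = Suc n"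
        using ne finS rS by (auto simp: n_def U card_gt_0_iff)
      have IH: "N A = fact (card A) * sec_tan_fps $ card A" "R A = fact (card A) * rank1_fps $ card A"
        if "A \<subseteq> S" for A
      proof -
        have "A \<subset> U" using that rS by (auto simp: U)
        from psubset.IH[OF this] show "N A = fact (card A) * sec_tan_fps $ card A"
          "R A = fact (card A) * rank1_fps $ card A" by (auto simp: N_def R_def)
      qed
      have mS: "Max S \<in> S" using finS ne by simp
      have compl: "S - (S - A) = A" if "A \<subseteq> S" for A using that by blast
      have fin: "finite (dec_trees A)" if "A \<subseteq> S" for A
        using finite_dec_trees finite_subset[OF that finS] .
      define X where "X = (\<lambda>A :: nat set. fact (card A) * fps_X $ card A :: complex)"
      \<comment> \<open>A singleton carries exactly one tree, so the indicator \<open>X\<close>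
        absorbs the count \<open>N\<close>.\<close>
      have X: "X A * N A = X A" "X A = of_bool (card A = 1)" if "A \<subseteq> S" for A
        unfolding X_def fps_X_nth_egf using Y1 by (auto simp: IH[OF that])
      have sumN: "N U = (\<Sum>A | Max S \<in> A \<and> A \<subseteq> S. N A * N (S - A))"
        using sum_dec_trees_insert[OF finS less_r ne, of "\<lambda>_. 1 :: complex"]
        by (simp add: N_def U)
      have "2 * N U = (\<Sum>A\<in>Pow S. N A * N (S - A))"
        unfolding sumN by (rule sum_subsets_containing[OF finS mS]) (simp add: compl mult.commute)
      also have "\<dots> = (\<Sum>A\<in>Pow S. (fact (card A) * sec_tan_fps $ card A)
            * (fact (card (S - A)) * sec_tan_fps $ card (S - A)))"
        by (intro sum.cong refl) (simp add: IH)
      also have "\<dots> = fact n * (sec_tan_fps * sec_tan_fps) $ n"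
        unfolding n_def by (rule sum_Pow_egf[OF finS])
      \<comment> \<open>As n > 0, the constant 1 of the Riccati equation does not
        contribute.\<close>
      also have "(sec_tan_fps * sec_tan_fps) $ n = (2 * fps_deriv sec_tan_fps) $ n"
        unfolding sec_tan_fps_riccati using n by simp
      finally have N: "N U = fact (card U) * sec_tan_fps $ card U"
        by (simp add: cU)
      have sumR: "R U = (\<Sum>A | Max S \<in> A \<and> A \<subseteq> S.
          R A * N (S - A) + N A * R (S - A) + (X A * N (S - A) + N A * X (S - A) - X A * X (S - A)))"
      proof -
        have "R U = (\<Sum>A | Max S \<in> A \<and> A \<subseteq> S. \<Sum>T1\<in>dec_trees A. \<Sum>T2\<in>dec_trees (S - A).
           of_nat (card (rank1_vertices (join_trees r A (S - A) T1 T2))))"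
          unfolding R_def U by (rule sum_dec_trees_insert[OF finS less_r ne])
        also have "\<dots> = (\<Sum>A | Max S \<in> A \<and> A \<subseteq> S. \<Sum>T1\<in>dec_trees A. \<Sum>T2\<in>dec_trees (S - A).
           of_nat (card (rank1_vertices T1)) + of_nat (card (rank1_vertices T2))
             + of_bool (card A = 1 \<or> card (S - A) = 1))"
        proof (intro sum.cong refl)
          fix A T1 T2
          assume "A \<in> {A. Max S \<in> A \<and> A \<subseteq> S}" "T1 \<in> dec_trees A" "T2 \<in> dec_trees (S - A)"
          then interpret tree_join r A "S - A" T1 T2
            using finS less_r by unfold_locales (auto intro: finite_subset)
          show "of_nat (card (rank1_vertices (join_trees r A (S - A) T1 T2))) =
             of_nat (card (rank1_vertices T1)) + of_nat (card (rank1_vertices T2))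
             + (of_bool (card A = 1 \<or> card (S - A) = 1) :: complex)"
            unfolding card_rank1_vertices_join by simp
        qed
        also have "\<dots> = (\<Sum>A | Max S \<in> A \<and> A \<subseteq> S. R A * N (S - A) + N A * R (S - A)
            + of_bool (card A = 1 \<or> card (S - A) = 1) * N A * N (S - A))"
          by (intro sum.cong refl)
             (simp add: sum.distrib N_def R_def mult_ac flip: sum_distrib_left sum_distrib_right)
        also have "\<dots> = (\<Sum>A | Max S \<in> A \<and> A \<subseteq> S. R A * N (S - A) + N A * R (S - A)
            + (X A * N (S - A) + N A * X (S - A) - X A * X (S - A)))"
        proof (intro sum.cong refl arg_cong2[of _ _ _ _ "(+)"])
          fix A assume "A \<in> {A. Max S \<in> A \<and> A \<subseteq> S}"
          hence A: "A \<subseteq> S" "S - A \<subseteq> S" by auto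
          \<comment> \<open>Inclusion-exclusion splits the condition into products of a factor in
            \<open>A\<close> and a factor in \<open>S - A\<close>, the shape that
            \<open>sum_Pow_egf\<close> handles. The subtracted product is the source of the term
            z^2.\<close>
          have "of_bool (card A = 1 \<or> card (S - A) = 1) = X A + X (S - A) - X A * X (S - A)"
            unfolding X(2)[OF A(1)] X(2)[OF A(2)] by simp
          hence "of_bool (card A = 1 \<or> card (S - A) = 1) * N A * N (S - A)
             = (X A * N A) * N (S - A) + N A * (X (S - A) * N (S - A)) - (X A * N A) * (X (S - A) * N (S - A))"
            by (simp only: ring_distribs mult_ac)
          thus "of_bool (card A = 1 \<or> card (S - A) = 1) * N A * N (S - A)
             = X A * N (S - A) + N A * X (S - A) - X A * X (S - A)"
            unfolding X(1)[OF A(1)] X(1)[OF A(2)] .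
        qed
        finally show ?thesis .
      qed
      have egf: "(\<Sum>A\<in>Pow S. f A * g (S - A)) = fact n * (F * G) $ n"
        if "\<And>A. A \<subseteq> S \<Longrightarrow> f A = fact (card A) * F $ card A"
          "\<And>A. A \<subseteq> S \<Longrightarrow> g A = fact (card A) * G $ card A" for f g and F G :: "complex fps"
      proof -
        have "(\<Sum>A\<in>Pow S. f A * g (S - A)) =
           (\<Sum>A\<in>Pow S. (fact (card A) * F $ card A) * (fact (card (S - A)) * G $ card (S - A)))"
          by (intro sum.cong refl) (simp add: that)
        thus ?thesis unfolding n_def sum_Pow_egf[OF finS] .
      qed
      have "2 * R U = (\<Sum>A\<in>Pow S.
          R A * N (S - A) + N A * R (S - A) + (X A * N (S - A) + N A * X (S - A) - X A * X (S - A)))"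
        unfolding sumR by (rule sum_subsets_containing[OF finS mS]) (simp add: compl)
      also have "\<dots> = fact n * (rank1_fps * sec_tan_fps) $ n + fact n * (sec_tan_fps * rank1_fps) $ n
          + (fact n * (fps_X * sec_tan_fps) $ n + fact n * (sec_tan_fps * fps_X) $ n
             - fact n * (fps_X * fps_X) $ n)"
        unfolding sum.distrib sum_subtractf
        by (intro arg_cong2[of _ _ _ _ "(+)"] arg_cong2[of _ _ _ _ "(-)"] egf IH) (auto simp: X_def)
      also have "\<dots> = fact n * (2 * rank1_fps * sec_tan_fps + 2 * fps_X * sec_tan_fps - fps_X ^ 2) $ n"
      proof -
        have "2 * rank1_fps * sec_tan_fps + 2 * fps_X * sec_tan_fps - fps_X ^ 2 =
          rank1_fps * sec_tan_fps + sec_tan_fps * rank1_fps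
            + (fps_X * sec_tan_fps + sec_tan_fps * fps_X - fps_X * fps_X)"
          by (simp add: power2_eq_square mult_2 algebra_simps)
        thus ?thesis by (simp only: fps_add_nth fps_sub_nth ring_distribs)
      qed
      also have "\<dots> = fact n * (2 * fps_deriv rank1_fps) $ n"
        unfolding rank1_fps_deriv ..
      finally have "R U = fact (card U) * rank1_fps $ card U"
        by (simp add: cU)
      with N show ?thesis by (simp add: N_def R_def)
    qed
  qed
qed

lemma num_trees_eq:
  assumes "n \<ge> 1"
  shows "of_nat (num_trees n) = fact n * sec_tan_fps $ n"
  using dec_trees_egf[of "{1..n}"] trees12_eq_dec_trees[OF assms] by (simp add: num_trees_def)

lemma num_rank_1_eq:
  assumes "n \<ge> 1"
  shows "of_nat (num_rank 1 n) = fact n * rank1_fps $ n"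
proof -
  have "card {v \<in> {1..n}. vertex_rank T v = 1} = card (rank1_vertices T)" if T: "T \<in> dec_trees {1..n}" for T
  proof (rule arg_cong[of _ _ card])
    have "rank1_vertices T \<subseteq> {1..n}"
      using dec_treesD(1)[OF T] by (auto simp: rank1_vertices_def)
    thus "{v \<in> {1..n}. vertex_rank T v = 1} = rank1_vertices T"
      using vertex_rank_eq_1_iff[OF T finite_atLeastAtMost] by blast
  qed
  hence "num_rank 1 n = (\<Sum>T\<in>dec_trees {1..n}. card (rank1_vertices T))"
    unfolding num_rank_def trees12_eq_dec_trees[OF assms] by (intro sum.cong refl)
  thus ?thesis using dec_trees_egf[of "{1..n}"] by simp
qed

theorem theorem2p5:
  shows "((\<lambda>n. real (num_rank 1 n) / (real (n + 1) * real (num_trees n)))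
            \<longlonglongrightarrow> 2 - pi\<^sup>2 / 24 - 4 / pi)
         \<and> \<bar>(2 - pi\<^sup>2 / 24 - 4 / pi) - 0.3155269391\<bar> < 1 / 10 ^ 9"
proof
  have "(\<lambda>n. complex_of_real (real (num_rank 1 n) / (real (n + 1) * real (num_trees n))))
     \<longlonglongrightarrow> of_real (2 - pi\<^sup>2 / 24 - 4 / pi)"
  proof (rule Lim_transform_eventually[OF rank1_fps_sec_tan_fps_ratio])
    show "\<forall>\<^sub>F n in sequentially. rank1_fps $ n / (of_nat (n + 1) * sec_tan_fps $ n) =
       complex_of_real (real (num_rank 1 n) / (real (n + 1) * real (num_trees n)))"
      using eventually_ge_at_top[of 1]
    proof eventually_elim
      case (elim n)
      have "complex_of_real (real (num_rank 1 n) / (real (n + 1) * real (num_trees n)))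
         = of_nat (num_rank 1 n) / (of_nat (n + 1) * of_nat (num_trees n))" by simp
      thus ?case unfolding num_rank_1_eq[OF elim] num_trees_eq[OF elim] by simp
    qed
  qed
  thus "(\<lambda>n. real (num_rank 1 n) / (real (n + 1) * real (num_trees n))) \<longlonglongrightarrow> 2 - pi\<^sup>2 / 24 - 4 / pi"
    by (simp only: tendsto_of_real_iff)
qed (rule rank1_constant_bounds)

end
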